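(* Let $k$ be a field, let $\operatorname{Spec}(A)$ be a $\mathbb{G}_m$-variety over $k$ with action $\beta$, written $(w,x)\mapsto w\bullet x$, let $h\in A$ be such that $D(h)$ is a $\mathbb{G}_m$-stable open subvariety of $\operatorname{Spec}(A)$, and let $q\in\mathbb{N}$. The following are equivalent: (a) there is a morphism $\Phi: D(h)\to(\mathbb{G}_m)^{q}$ such that $\Phi\circ\beta=\gamma_q\circ(\operatorname{id}_{\mathbb{G}_m},\Phi)$ as morphisms $\mathbb{G}_m\times D(h)\to(\mathbb{G}_m)^{q}$; (b) there is an $e\in\mathbb{N}_0$ and $g\in A_h^{\ast}$ such that $g/h^{e}$ is a semi-invariant of weight $q$, i.e. $(g/h^{e})(w\bullet x)=w^{q}\,(g/h^{e})(x)$ for all $w\in\mathbb{G}_m$ and $x\in D(h)$.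
   Context: $D(h)\subseteq\operatorname{Spec}(A)$ is the principal open set where $h\ne0$, with coordinate ring $A_h$; $A_h^{\ast}$ is the group of units of $A_h$. $\mathbb{N}$ is the set of positive integers and $\mathbb{N}_0=\mathbb{N}\cup\{0\}$. $(\mathbb{G}_m)^{q}$ denotes the $\mathbb{G}_m$-variety whose underlying variety is $\mathbb{G}_m$ (not a $q$-fold product), with action $\gamma_q:\mathbb{G}_m\times(\mathbb{G}_m)^{q}\to(\mathbb{G}_m)^{q}$ sending $(w,s)$ to $w^{q}s$. The morphism $(\operatorname{id}_{\mathbb{G}_m},\Phi)$ sends $(w,x)$ to $(w,\Phi(x))$. *)

theory Defs
  imports "HOL-Algebra.Module" "HOL-Algebra.Generated_Rings"
begin

text \<open>
  Schemes over \<open>k\<close> are treated through their functors of points. A test algebra is a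
  \<open>k\<close>-algebra \<open>R\<close> whose carrier is a set of elements of the type \<open>'u\<close>, which plays the role of a
  universe. If \<open>'u\<close> is infinite, then every finitely generated commutative algebra over a \<open>k\<close>-algebra in the
  universe is isomorphic to one in the universe. In particular this holds for the coordinate rings
  of \<open>D(h)\<close>, of \<open>\<bbbG>\<^sub>m \<times> Spec(A)\<close>, of \<open>\<bbbG>\<^sub>m \<times> D(h)\<close> and of \<open>\<bbbG>\<^sub>m \<times> \<bbbG>\<^sub>m \<times> Spec(A)\<close>, so by Yoneda's lemma
  the morphisms between these schemes are exactly the natural maps defined below.
\<close>


section \<open>Functors of points\<close>

definition alg_hom ::
    "('k, 'm) ring_scheme \<Rightarrow> ('k, 'a) module \<Rightarrow> ('k, 'b) module \<Rightarrow> ('a \<Rightarrow> 'b) set" where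
  "alg_hom k A B = {f \<in> ring_hom A B. f \<in> extensional (carrier A) \<and>
     (\<forall>c\<in>carrier k. \<forall>a\<in>carrier A. f (c \<odot>\<^bsub>A\<^esub> a) = c \<odot>\<^bsub>B\<^esub> f a)}"

text \<open>\<open>pts F R\<close> is the set \<open>F(R)\<close>; for a homomorphism \<open>t : R \<rightarrow> R'\<close>, \<open>push F t\<close> is the
  map \<open>F(t) : F(R) \<rightarrow> F(R')\<close>.\<close>

record ('k, 'u, 'p) kfunctor =
  pts :: "('k, 'u) module \<Rightarrow> 'p set"
  push :: "('u \<Rightarrow> 'u) \<Rightarrow> 'p \<Rightarrow> 'p"

definition Spec :: "('k, 'm) ring_scheme \<Rightarrow> ('k, 'u) module \<Rightarrow> ('k, 'u, 'u \<Rightarrow> 'u) kfunctor" where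
  "Spec k A = \<lparr>pts = (\<lambda>R. alg_hom k A R), push = (\<lambda>t x. compose (carrier A) t x)\<rparr>"

text \<open>The principal open set where \<open>h \<noteq> 0\<close>: a morphism \<open>Spec(R) \<rightarrow> Spec(A)\<close> with
  comorphism \<open>x\<close> has its image in \<open>D(h)\<close> iff the pullback \<open>x(h)\<close> of \<open>h\<close> vanishes nowhere on
  \<open>Spec(R)\<close>, that is, iff \<open>x(h)\<close> is a unit of \<open>R\<close>.\<close>

definition Dopen ::
    "('k, 'm) ring_scheme \<Rightarrow> ('k, 'u) module \<Rightarrow> 'u \<Rightarrow> ('k, 'u, 'u \<Rightarrow> 'u) kfunctor" where
  "Dopen k A h =
     \<lparr>pts = (\<lambda>R. {x \<in> pts (Spec k A) R. x h \<in> Units R}), push = push (Spec k A)\<rparr>"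

definition Gm :: "('k, 'u, 'u) kfunctor" where
  "Gm = \<lparr>pts = (\<lambda>R. Units R), push = (\<lambda>t w. t w)\<rparr>"

definition prod_functor ::
    "('k, 'u, 'p) kfunctor \<Rightarrow> ('k, 'u, 'q) kfunctor \<Rightarrow> ('k, 'u, 'p \<times> 'q) kfunctor"
    (infixr \<open>\<times>\<^sub>F\<close> 80) where
  "F \<times>\<^sub>F G = \<lparr>pts = (\<lambda>R. pts F R \<times> pts G R), push = (\<lambda>t. map_prod (push F t) (push G t))\<rparr>"

type_synonym ('k, 'u, 'p, 'q) kmap = "('k, 'u) module \<Rightarrow> 'p \<Rightarrow> 'q"

definition morphism ::
    "('k, 'm) ring_scheme \<Rightarrow> ('k, 'u, 'p) kfunctor \<Rightarrow> ('k, 'u, 'q) kfunctor \<Rightarrow>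
     ('k, 'u, 'p, 'q) kmap \<Rightarrow> bool" where
  "morphism k F G \<Phi> \<longleftrightarrow>
     (\<forall>R. algebra k R \<longrightarrow> (\<forall>p\<in>pts F R. \<Phi> R p \<in> pts G R)) \<and>
     (\<forall>R R'. algebra k R \<longrightarrow> algebra k R' \<longrightarrow>
        (\<forall>t\<in>alg_hom k R R'. \<forall>p\<in>pts F R. \<Phi> R' (push F t p) = push G t (\<Phi> R p)))"

text \<open>Equality of two morphisms with source \<open>F\<close>; the values of a \<open>kmap\<close> outside the points
  of its source carry no meaning.\<close>

definition mor_eq ::
    "('k, 'm) ring_scheme \<Rightarrow> ('k, 'u, 'p) kfunctor \<Rightarrow>
     ('k, 'u, 'p, 'q) kmap \<Rightarrow> ('k, 'u, 'p, 'q) kmap \<Rightarrow> bool" where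
  "mor_eq k F \<Phi> \<Psi> \<longleftrightarrow> (\<forall>R. algebra k R \<longrightarrow> (\<forall>p\<in>pts F R. \<Phi> R p = \<Psi> R p))"

definition mor_comp ::
    "('k, 'u, 'q, 'r) kmap \<Rightarrow> ('k, 'u, 'p, 'q) kmap \<Rightarrow> ('k, 'u, 'p, 'r) kmap"
    (infixl \<open>\<circ>\<^sub>M\<close> 55) where
  "\<Psi> \<circ>\<^sub>M \<Phi> = (\<lambda>R p. \<Psi> R (\<Phi> R p))"

definition id_times :: "('k, 'u, 'p, 'q) kmap \<Rightarrow> ('k, 'u, 'u \<times> 'p, 'u \<times> 'q) kmap" where
  "id_times \<Phi> = (\<lambda>R (w, x). (w, \<Phi> R x))"


section \<open>Actions of the multiplicative group\<close>

definition Gm_action ::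
    "('k, 'm) ring_scheme \<Rightarrow> ('k, 'u, 'p) kfunctor \<Rightarrow> ('k, 'u, 'u \<times> 'p, 'p) kmap \<Rightarrow> bool" where
  "Gm_action k X \<beta> \<longleftrightarrow>
     morphism k (Gm \<times>\<^sub>F X) X \<beta> \<and>
     (\<forall>R. algebra k R \<longrightarrow> (\<forall>x\<in>pts X R.
        \<beta> R (\<one>\<^bsub>R\<^esub>, x) = x \<and>
        (\<forall>v\<in>pts Gm R. \<forall>w\<in>pts Gm R. \<beta> R (v \<otimes>\<^bsub>R\<^esub> w, x) = \<beta> R (v, \<beta> R (w, x)))))"

text \<open>An affine variety over the field \<open>k\<close> is the spectrum of a finitely generated reduced
  algebra; irreducibility is not required.\<close>

definition affine_variety :: "('k, 'm) ring_scheme \<Rightarrow> ('k, 'u) module \<Rightarrow> bool" where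
  "affine_variety k A \<longleftrightarrow> algebra k A \<and>
     (\<exists>S. finite S \<and> S \<subseteq> carrier A \<and>
        generate_ring A ((\<lambda>c. c \<odot>\<^bsub>A\<^esub> \<one>\<^bsub>A\<^esub>) ` carrier k \<union> S) = carrier A) \<and>
     (\<forall>a\<in>carrier A. \<forall>n::nat. a [^]\<^bsub>A\<^esub> n = \<zero>\<^bsub>A\<^esub> \<longrightarrow> a = \<zero>\<^bsub>A\<^esub>)"

definition affine_Gm_variety ::
    "('k, 'm) ring_scheme \<Rightarrow> ('k, 'u) module \<Rightarrow> ('k, 'u, 'u \<times> ('u \<Rightarrow> 'u), 'u \<Rightarrow> 'u) kmap \<Rightarrow> bool" where
  "affine_Gm_variety k A \<beta> \<longleftrightarrow> affine_variety k A \<and> Gm_action k (Spec k A) \<beta>"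

definition Gm_stable ::
    "('k, 'm) ring_scheme \<Rightarrow> ('k, 'u, 'u \<times> 'p, 'p) kmap \<Rightarrow> ('k, 'u, 'p) kfunctor \<Rightarrow> bool" where
  "Gm_stable k \<beta> U \<longleftrightarrow>
     (\<forall>R. algebra k R \<longrightarrow> (\<forall>w\<in>pts Gm R. \<forall>x\<in>pts U R. \<beta> R (w, x) \<in> pts U R))"

definition gamma :: "nat \<Rightarrow> ('k, 'u, 'u \<times> 'u, 'u) kmap" where
  "gamma q = (\<lambda>R (w, s). w [^]\<^bsub>R\<^esub> q \<otimes>\<^bsub>R\<^esub> s)"


section \<open>The coordinate ring of a principal open set\<close>

text \<open>\<open>loc_frac A h a m\<close> is the fraction \<open>a / h\<^sup>m\<close>, as the set of all pairs \<open>(b, n)\<close> with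
  \<open>b / h\<^sup>n = a / h\<^sup>m\<close>.\<close>

definition loc_frac :: "('a, 'm) ring_scheme \<Rightarrow> 'a \<Rightarrow> 'a \<Rightarrow> nat \<Rightarrow> ('a \<times> nat) set" where
  "loc_frac A h a m = {(b, n). b \<in> carrier A \<and>
     (\<exists>l::nat. h [^]\<^bsub>A\<^esub> l \<otimes>\<^bsub>A\<^esub> (h [^]\<^bsub>A\<^esub> n \<otimes>\<^bsub>A\<^esub> a) =
               h [^]\<^bsub>A\<^esub> l \<otimes>\<^bsub>A\<^esub> (h [^]\<^bsub>A\<^esub> m \<otimes>\<^bsub>A\<^esub> b))}"

definition loc :: "('k, 'a) module \<Rightarrow> 'a \<Rightarrow> ('k, ('a \<times> nat) set) module" where
  "loc A h =
     \<lparr>carrier = {loc_frac A h a m | a m. a \<in> carrier A},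
      mult = (\<lambda>X Y. \<Union>(a, m)\<in>X. \<Union>(b, n)\<in>Y. loc_frac A h (a \<otimes>\<^bsub>A\<^esub> b) (m + n)),
      one = loc_frac A h \<one>\<^bsub>A\<^esub> 0,
      zero = loc_frac A h \<zero>\<^bsub>A\<^esub> 0,
      add = (\<lambda>X Y. \<Union>(a, m)\<in>X. \<Union>(b, n)\<in>Y.
               loc_frac A h (h [^]\<^bsub>A\<^esub> n \<otimes>\<^bsub>A\<^esub> a \<oplus>\<^bsub>A\<^esub> h [^]\<^bsub>A\<^esub> m \<otimes>\<^bsub>A\<^esub> b) (m + n)),
      smult = (\<lambda>c X. \<Union>(a, m)\<in>X. loc_frac A h (c \<odot>\<^bsub>A\<^esub> a) m)\<rparr>"

text \<open>The value at \<open>x \<in> D(h)(R)\<close> of the regular function \<open>f \<in> A\<^sub>h\<close>: if \<open>f = a / h\<^sup>n\<close>, it is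
  \<open>x(a) x(h)\<^sup>-\<^sup>n\<close>, whichever representative \<open>(a, n)\<close> of \<open>f\<close> is used.\<close>

definition loc_eval ::
    "'u \<Rightarrow> ('k, 'u) module \<Rightarrow> ('u \<times> nat) set \<Rightarrow> ('u \<Rightarrow> 'u) \<Rightarrow> 'u" where
  "loc_eval h R f x = (THE r. \<forall>(a, n)\<in>f. r = x a \<otimes>\<^bsub>R\<^esub> inv\<^bsub>R\<^esub> (x h [^]\<^bsub>R\<^esub> n))"

text \<open>The field may be finite, so the points \<open>w\<close> and \<open>x\<close> range over all test algebras.\<close>

definition semi_invariant ::
    "('k, 'm) ring_scheme \<Rightarrow> ('k, 'u) module \<Rightarrow> 'u \<Rightarrow>
     ('k, 'u, 'u \<times> ('u \<Rightarrow> 'u), 'u \<Rightarrow> 'u) kmap \<Rightarrow> nat \<Rightarrow> ('u \<times> nat) set \<Rightarrow> bool" where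
  "semi_invariant k A h \<beta> q f \<longleftrightarrow>
     (\<forall>R. algebra k R \<longrightarrow> (\<forall>w\<in>pts Gm R. \<forall>x\<in>pts (Dopen k A h) R.
        loc_eval h R f (\<beta> R (w, x)) = w [^]\<^bsub>R\<^esub> q \<otimes>\<^bsub>R\<^esub> loc_eval h R f x))"

end

theory Submission
  imports Defs "HOL-Algebra.Multiplicative_Group"
begin

text \<open>
  An equivariant morphism from \<open>D(h)\<close> to \<open>\<bbbG>\<^sub>m\<close> with the action of weight \<open>q\<close> is the same thing as a
  unit \<open>f\<close> of \<open>A\<^sub>h\<close> that is semi-invariant of weight \<open>q\<close>; the correspondence sends \<open>f\<close> to the natural
  map \<open>x \<mapsto> f(x)\<close>. Since \<open>h\<close> is a unit of \<open>A\<^sub>h\<close>, the elements \<open>g / h\<^sup>e\<close> with \<open>g\<close> a unit are exactly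
  the units of \<open>A\<^sub>h\<close>, and the exponent \<open>e = 0\<close> already gives all of them.

  A point \<open>x\<close> of \<open>D(h)\<close> over \<open>R\<close> extends uniquely to a homomorphism \<open>A\<^sub>h \<rightarrow> R\<close>, namely
  \<open>f \<mapsto> f(x)\<close> (lemma \<open>eval_hom_alg_hom\<close>). Homomorphisms preserve units, so a unit \<open>f\<close> of \<open>A\<^sub>h\<close>
  takes unit values, naturally in \<open>R\<close> (lemma \<open>morphism_loc_eval\<close>). Conversely every morphism
  from \<open>D(h)\<close> to \<open>\<bbbG>\<^sub>m\<close> arises in this way (lemma \<open>morphism_Dopen_Gm_is_loc_eval\<close>). This is
  Yoneda's lemma: \<open>D(h)\<close> is represented by \<open>A\<^sub>h\<close>, and \<open>f\<close> is the value of the morphism at the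
  universal point \<open>A \<rightarrow> A\<^sub>h\<close>. The elements of \<open>A\<^sub>h\<close> are sets of pairs, so \<open>A\<^sub>h\<close> is not
  itself a test algebra; but the universe is infinite, so it contains a copy of \<open>A\<^sub>h\<close>
  (lemmas \<open>loc_embeds\<close> and \<open>transport_algebra\<close>).

  Under this correspondence the equivariance of the morphism is literally the equation that defines
  semi-invariance, once the stability of \<open>D(h)\<close> ensures that \<open>w \<bullet> x\<close> is again a point of \<open>D(h)\<close>.
\<close>

section \<open>Localization at the powers of one element\<close>

locale principal_open = cring A for A :: "('k, 'a) module" (structure) +
  fixes h :: 'a
  assumes h_closed [simp]: "h \<in> carrier A"
begin

abbreviation frac :: "'a \<Rightarrow> nat \<Rightarrow> ('a \<times> nat) set" where
  "frac \<equiv> loc_frac A h"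

lemma frac_self: "a \<in> carrier A \<Longrightarrow> (a, m) \<in> frac a m"
  by (simp add: loc_frac_def)

text \<open>Transitivity of the equality of fractions. As \<open>h\<close> may be a zero divisor, the middle
  denominator \<open>h\<^sup>n\<close> cannot be cancelled; it is moved into the power of \<open>h\<close> that annihilates the
  difference.\<close>

lemma frac_trans:
  assumes "a \<in> carrier A" "b \<in> carrier A" "c \<in> carrier A"
    and 1: "h [^] (l::nat) \<otimes> (h [^] (n::nat) \<otimes> a) = h [^] l \<otimes> (h [^] (m::nat) \<otimes> b)"
    and 2: "h [^] (l'::nat) \<otimes> (h [^] (p::nat) \<otimes> b) = h [^] l' \<otimes> (h [^] n \<otimes> c)"
  shows "h [^] (l + l' + n) \<otimes> (h [^] p \<otimes> a) = h [^] (l + l' + n) \<otimes> (h [^] m \<otimes> c)"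
proof -
  have "h [^] (l + l' + n) \<otimes> (h [^] p \<otimes> a)
      = h [^] l' \<otimes> h [^] p \<otimes> (h [^] l \<otimes> (h [^] n \<otimes> a))"
    using assms(1-3) by (simp add: nat_pow_mult [symmetric] m_ac)
  also have "\<dots> = h [^] l \<otimes> h [^] m \<otimes> (h [^] l' \<otimes> (h [^] p \<otimes> b))"
    unfolding 1 using assms(1-3) by (simp add: m_ac)
  also have "\<dots> = h [^] (l + l' + n) \<otimes> (h [^] m \<otimes> c)"
    unfolding 2 using assms(1-3) by (simp add: nat_pow_mult [symmetric] m_ac)
  finally show ?thesis .
qed

lemma frac_eqI_mem:
  assumes "a \<in> carrier A" "(b, n) \<in> frac a m"
  shows "frac b n = frac a m"
proof -
  from assms obtain l :: nat where b: "b \<in> carrier A"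
    and l: "h [^] l \<otimes> (h [^] n \<otimes> a) = h [^] l \<otimes> (h [^] m \<otimes> b)"
    by (auto simp: loc_frac_def)
  show ?thesis
    unfolding loc_frac_def
    using frac_trans[OF assms(1) b _ l] frac_trans[OF b assms(1) _ l[symmetric]] by blast
qed

lemma frac_eqI:
  assumes "a \<in> carrier A" "b \<in> carrier A" "h [^] (n::nat) \<otimes> a = h [^] (m::nat) \<otimes> b"
  shows "frac a m = frac b n"
  by (rule frac_eqI_mem[symmetric]) (use assms in \<open>auto simp: loc_frac_def\<close>)

text \<open>Expanding a fraction by a power of \<open>h\<close>: this bridges the places where the two sides of an
  algebra axiom for \<open>A\<^sub>h\<close> come out with different denominators.\<close>

lemma frac_cancel:
  "a \<in> carrier A \<Longrightarrow> frac (h [^] (p::nat) \<otimes> a) (p + m) = frac a m"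
  by (rule frac_eqI) (auto simp: nat_pow_mult [symmetric] m_ac)

lemma carrier_loc: "carrier (loc A h) = {frac a m | a m. a \<in> carrier A}"
  by (simp add: loc_def)

lemma frac_closed [simp]: "a \<in> carrier A \<Longrightarrow> frac a m \<in> carrier (loc A h)"
  by (auto simp: carrier_loc)

lemma loc_cases:
  assumes "X \<in> carrier (loc A h)"
  obtains a m where "a \<in> carrier A" "X = frac a m"
  using assms by (auto simp: carrier_loc)

lemma loc_one: "\<one>\<^bsub>loc A h\<^esub> = frac \<one> 0" and loc_zero: "\<zero>\<^bsub>loc A h\<^esub> = frac \<zero> 0"
  by (simp_all add: loc_def)

lemma mult_congruent:
  assumes ab: "a \<in> carrier A" "b \<in> carrier A"
    and "(a', m') \<in> frac a m" "(b', n') \<in> frac b n"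
  shows "frac (a' \<otimes> b') (m' + n') = frac (a \<otimes> b) (m + n)"
proof -
  from assms obtain k l :: nat where c: "a' \<in> carrier A" "b' \<in> carrier A"
    and k: "h [^] k \<otimes> (h [^] m' \<otimes> a) = h [^] k \<otimes> (h [^] m \<otimes> a')"
    and l: "h [^] l \<otimes> (h [^] n' \<otimes> b) = h [^] l \<otimes> (h [^] n \<otimes> b')"
    by (auto simp: loc_frac_def)
  have "h [^] (k + l) \<otimes> (h [^] (m' + n') \<otimes> (a \<otimes> b))
      = h [^] k \<otimes> (h [^] m' \<otimes> a) \<otimes> (h [^] l \<otimes> (h [^] n' \<otimes> b))"
    using ab c by (simp add: nat_pow_mult [symmetric] m_ac)
  also have "\<dots> = h [^] (k + l) \<otimes> (h [^] (m + n) \<otimes> (a' \<otimes> b'))"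
    unfolding k l using ab c by (simp add: nat_pow_mult [symmetric] m_ac)
  finally show ?thesis
    using ab c by (intro frac_eqI_mem) (auto simp: loc_frac_def)
qed

lemma add_congruent:
  assumes ab: "a \<in> carrier A" "b \<in> carrier A"
    and "(a', m') \<in> frac a m" "(b', n') \<in> frac b n"
  shows "frac (h [^] n' \<otimes> a' \<oplus> h [^] m' \<otimes> b') (m' + n')
       = frac (h [^] n \<otimes> a \<oplus> h [^] m \<otimes> b) (m + n)"
proof -
  from assms obtain k l :: nat where c: "a' \<in> carrier A" "b' \<in> carrier A"
    and k: "h [^] k \<otimes> (h [^] m' \<otimes> a) = h [^] k \<otimes> (h [^] m \<otimes> a')"
    and l: "h [^] l \<otimes> (h [^] n' \<otimes> b) = h [^] l \<otimes> (h [^] n \<otimes> b')"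
    by (auto simp: loc_frac_def)
  have "h [^] (k + l) \<otimes> (h [^] (m' + n') \<otimes> (h [^] n \<otimes> a \<oplus> h [^] m \<otimes> b))
      = h [^] l \<otimes> h [^] n' \<otimes> h [^] n \<otimes> (h [^] k \<otimes> (h [^] m' \<otimes> a))
        \<oplus> h [^] k \<otimes> h [^] m' \<otimes> h [^] m \<otimes> (h [^] l \<otimes> (h [^] n' \<otimes> b))"
    using ab c by (simp add: nat_pow_mult [symmetric] r_distr m_ac)
  also have "\<dots> = h [^] (k + l) \<otimes> (h [^] (m + n) \<otimes> (h [^] n' \<otimes> a' \<oplus> h [^] m' \<otimes> b'))"
    unfolding k l using ab c by (simp add: nat_pow_mult [symmetric] r_distr m_ac)
  finally show ?thesis
    using ab c by (intro frac_eqI_mem) (auto simp: loc_frac_def)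
qed

lemma loc_mult:
  assumes "a \<in> carrier A" "b \<in> carrier A"
  shows "frac a m \<otimes>\<^bsub>loc A h\<^esub> frac b n = frac (a \<otimes> b) (m + n)"
  by (auto simp: loc_def mult_congruent[OF assms]
      intro!: UN_constant_eq[OF frac_self] assms)

lemma loc_add:
  assumes "a \<in> carrier A" "b \<in> carrier A"
  shows "frac a m \<oplus>\<^bsub>loc A h\<^esub> frac b n = frac (h [^] n \<otimes> a \<oplus> h [^] m \<otimes> b) (m + n)"
  by (auto simp: loc_def add_congruent[OF assms]
      intro!: UN_constant_eq[OF frac_self] assms)

lemma loc_cring: "cring (loc A h)"
proof (rule cringI)
  show "abelian_group (loc A h)"
  proof (rule abelian_groupI)
    fix X assume "X \<in> carrier (loc A h)"
    then obtain a m where X: "a \<in> carrier A" "X = frac a m" by (rule loc_cases)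
    have "frac \<zero> (m + m) = frac \<zero> 0"
      by (rule frac_eqI) auto
    then have "frac (\<ominus> a) m \<oplus>\<^bsub>loc A h\<^esub> X = \<zero>\<^bsub>loc A h\<^esub>"
      using X by (simp add: loc_add loc_zero r_minus l_neg)
    then show "\<exists>Y\<in>carrier (loc A h). Y \<oplus>\<^bsub>loc A h\<^esub> X = \<zero>\<^bsub>loc A h\<^esub>"
      using X by (intro bexI[of _ "frac (\<ominus> a) m"]) auto
  qed (auto elim!: loc_cases simp: loc_add loc_zero nat_pow_mult [symmetric] r_distr m_ac a_ac
      add.commute add.left_commute)
  show "comm_monoid (loc A h)"
    by (rule comm_monoidI) (auto elim!: loc_cases simp: loc_mult loc_one m_ac ac_simps)
  show "(X \<oplus>\<^bsub>loc A h\<^esub> Y) \<otimes>\<^bsub>loc A h\<^esub> Z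
      = X \<otimes>\<^bsub>loc A h\<^esub> Z \<oplus>\<^bsub>loc A h\<^esub> Y \<otimes>\<^bsub>loc A h\<^esub> Z"
    if XYZ: "X \<in> carrier (loc A h)" "Y \<in> carrier (loc A h)" "Z \<in> carrier (loc A h)" for X Y Z
  proof -
    obtain a m where X: "a \<in> carrier A" "X = frac a m" using XYZ(1) by (rule loc_cases)
    obtain b n where Y: "b \<in> carrier A" "Y = frac b n" using XYZ(2) by (rule loc_cases)
    obtain c p where Z: "c \<in> carrier A" "Z = frac c p" using XYZ(3) by (rule loc_cases)
    have "h [^] p \<otimes> ((h [^] n \<otimes> a \<oplus> h [^] m \<otimes> b) \<otimes> c)
        = h [^] (n + p) \<otimes> (a \<otimes> c) \<oplus> h [^] (m + p) \<otimes> (b \<otimes> c)"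
      using X Y Z by (simp add: nat_pow_mult [symmetric] l_distr r_distr m_ac)
    then have "frac ((h [^] n \<otimes> a \<oplus> h [^] m \<otimes> b) \<otimes> c) (m + n + p)
        = frac (h [^] (n + p) \<otimes> (a \<otimes> c) \<oplus> h [^] (m + p) \<otimes> (b \<otimes> c)) (p + (m + n + p))"
      using frac_cancel[of "(h [^] n \<otimes> a \<oplus> h [^] m \<otimes> b) \<otimes> c" p "m + n + p"] X Y Z by simp
    then show ?thesis
      using X Y Z by (simp add: loc_mult loc_add ac_simps)
  qed
qed

lemma frac_h_Units: "frac h 0 \<in> Units (loc A h)"
proof -
  interpret L: cring "loc A h" by (rule loc_cring)
  have "frac h 0 \<otimes>\<^bsub>loc A h\<^esub> frac \<one> 1 = \<one>\<^bsub>loc A h\<^esub>"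
    using frac_cancel[of \<one> 1 0] by (simp add: loc_mult loc_one)
  then have "\<exists>Y\<in>carrier (loc A h). Y \<otimes>\<^bsub>loc A h\<^esub> frac h 0 = \<one>\<^bsub>loc A h\<^esub>
      \<and> frac h 0 \<otimes>\<^bsub>loc A h\<^esub> Y = \<one>\<^bsub>loc A h\<^esub>"
    by (intro bexI[of _ "frac \<one> 1"] conjI) (simp_all only: L.m_comm frac_closed h_closed one_closed)
  then show ?thesis
    unfolding Units_def by (intro CollectI conjI) simp_all
qed

lemma loc_smult:
  assumes "algebra k A" "c \<in> carrier k" "a \<in> carrier A"
  shows "c \<odot>\<^bsub>loc A h\<^esub> frac a m = frac (c \<odot>\<^bsub>A\<^esub> a) m"
proof -
  interpret k: algebra k A by fact
  have push: "x \<otimes> (c \<odot>\<^bsub>A\<^esub> y) = c \<odot>\<^bsub>A\<^esub> (x \<otimes> y)"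
    if "x \<in> carrier A" "y \<in> carrier A" for x y
    using that assms(2) k.smult_assoc2[of c y x] by (simp add: m_comm)
  have "frac (c \<odot>\<^bsub>A\<^esub> b) n = frac (c \<odot>\<^bsub>A\<^esub> a) m" if bn: "(b, n) \<in> frac a m" for b n
  proof -
    from bn obtain l :: nat where b: "b \<in> carrier A"
      and l: "h [^] l \<otimes> (h [^] n \<otimes> a) = h [^] l \<otimes> (h [^] m \<otimes> b)"
      by (auto simp: loc_frac_def)
    have "h [^] l \<otimes> (h [^] n \<otimes> (c \<odot>\<^bsub>A\<^esub> a)) = h [^] l \<otimes> (h [^] m \<otimes> (c \<odot>\<^bsub>A\<^esub> b))"
      using l b assms by (simp add: push)
    then show ?thesis
      using b assms by (intro frac_eqI_mem) (auto simp: loc_frac_def)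
  qed
  then show ?thesis
    using assms by (auto simp: loc_def intro!: UN_constant_eq[OF frac_self])
qed

lemma loc_algebra:
  assumes "algebra k A"
  shows "algebra k (loc A h)"
proof -
  interpret k: algebra k A by fact
  have push: "x \<otimes> (c \<odot>\<^bsub>A\<^esub> y) = c \<odot>\<^bsub>A\<^esub> (x \<otimes> y)"
    if "c \<in> carrier k" "x \<in> carrier A" "y \<in> carrier A" for c x y
    using that k.smult_assoc2[of c y x] by (simp add: m_comm)
  show ?thesis
  proof (rule algebraI[OF k.R_cring loc_cring])
    fix c d X assume cd: "c \<in> carrier k" "d \<in> carrier k" and "X \<in> carrier (loc A h)"
    then obtain a m where X: "a \<in> carrier A" "X = frac a m" by (auto elim: loc_cases)
    have "frac ((c \<oplus>\<^bsub>k\<^esub> d) \<odot>\<^bsub>A\<^esub> a) m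
        = frac (h [^] m \<otimes> (c \<odot>\<^bsub>A\<^esub> a) \<oplus> h [^] m \<otimes> (d \<odot>\<^bsub>A\<^esub> a)) (m + m)"
      using frac_cancel[of "(c \<oplus>\<^bsub>k\<^esub> d) \<odot>\<^bsub>A\<^esub> a" m m] cd X
      by (simp add: k.smult_l_distr r_distr)
    then show "(c \<oplus>\<^bsub>k\<^esub> d) \<odot>\<^bsub>loc A h\<^esub> X = c \<odot>\<^bsub>loc A h\<^esub> X \<oplus>\<^bsub>loc A h\<^esub> d \<odot>\<^bsub>loc A h\<^esub> X"
      using cd X by (simp add: loc_smult[OF assms] loc_add)
  qed (auto elim!: loc_cases simp: loc_smult[OF assms] loc_add loc_mult push k.smult_r_distr
      k.smult_assoc1 k.smult_assoc2)
qed

end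

section \<open>Algebra homomorphisms and units\<close>

text \<open>Apart from the existence of additive inverses, for which \<open>f\<close> supplies the witness, the axioms
  of an algebra are equations between its operations, and these pass to every image of the
  operations; \<open>f\<close> may identify elements.\<close>

lemma algebra_image:
  fixes L :: "('k, 'a) module" and B :: "('k, 'b) module"
  assumes "algebra k L"
    and car: "carrier B = f ` carrier L"
    and [simp]: "\<one>\<^bsub>B\<^esub> = f \<one>\<^bsub>L\<^esub>" "\<zero>\<^bsub>B\<^esub> = f \<zero>\<^bsub>L\<^esub>"
    and [simp]: "\<And>x y. x \<in> carrier L \<Longrightarrow> y \<in> carrier L \<Longrightarrow> f x \<otimes>\<^bsub>B\<^esub> f y = f (x \<otimes>\<^bsub>L\<^esub> y)"
    and [simp]: "\<And>x y. x \<in> carrier L \<Longrightarrow> y \<in> carrier L \<Longrightarrow> f x \<oplus>\<^bsub>B\<^esub> f y = f (x \<oplus>\<^bsub>L\<^esub> y)"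
    and [simp]: "\<And>c x. c \<in> carrier k \<Longrightarrow> x \<in> carrier L \<Longrightarrow> c \<odot>\<^bsub>B\<^esub> f x = f (c \<odot>\<^bsub>L\<^esub> x)"
  shows "algebra k B"
proof -
  interpret L: algebra k L by fact
  show ?thesis
  proof (rule algebraI[OF L.R_cring])
    show "cring B"
    proof (rule cringI)
      show "abelian_group B"
      proof (rule abelian_groupI)
        fix x assume "x \<in> carrier B"
        then obtain a where "a \<in> carrier L" "x = f a" by (auto simp: car)
        then show "\<exists>y\<in>carrier B. y \<oplus>\<^bsub>B\<^esub> x = \<zero>\<^bsub>B\<^esub>"
          by (auto simp: car L.M.l_neg intro!: bexI[of _ "\<ominus>\<^bsub>L\<^esub> a"])
      qed (auto simp: car L.M.a_ac)
      show "comm_monoid B" by (rule comm_monoidI) (auto simp: car L.m_ac)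
    qed (auto simp: car L.l_distr)
  qed (auto simp: car L.smult_l_distr L.smult_r_distr L.smult_assoc1 L.smult_assoc2)
qed


lemma alg_hom_ring_hom_cring:
  assumes "algebra k B" "algebra k C" "f \<in> alg_hom k B C"
  shows "ring_hom_cring B C f"
  using assms
  by (auto simp: alg_hom_def intro: algebra.M_cring ring_hom_cring.intro ring_hom_cring_axioms.intro)

lemma alg_hom_smult:
  "f \<in> alg_hom k B C \<Longrightarrow> c \<in> carrier k \<Longrightarrow> a \<in> carrier B \<Longrightarrow> f (c \<odot>\<^bsub>B\<^esub> a) = c \<odot>\<^bsub>C\<^esub> f a"
  by (simp add: alg_hom_def)

lemma alg_hom_compose:
  assumes "algebra k B" "f \<in> alg_hom k B C" "g \<in> alg_hom k C D"
  shows "compose (carrier B) g f \<in> alg_hom k B D"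
proof -
  interpret B: algebra k B by fact
  show ?thesis
    using assms(2,3) by (auto simp: alg_hom_def ring_hom_def compose_def Pi_iff)
qed

lemma (in ring_hom_cring) hom_Units:
  assumes "u \<in> Units R"
  shows "h u \<in> Units S" and "inv\<^bsub>S\<^esub> h u = h (inv u)"
proof -
  have u: "u \<in> carrier R" "inv u \<in> carrier R" using assms by auto
  have 1: "h u \<otimes>\<^bsub>S\<^esub> h (inv u) = \<one>\<^bsub>S\<^esub>"
    using assms u by (simp flip: hom_mult)
  show "inv\<^bsub>S\<^esub> h u = h (inv u)"
    using 1 u by (intro S.comm_inv_char) auto
  show "h u \<in> Units S"
    using 1 u S.m_comm[of "h u" "h (inv u)"] by (auto simp: Units_def)
qed

lemma (in cring) unit_fraction_eqI:
  assumes "u \<in> Units R" "v \<in> Units R" "a \<in> carrier R" "b \<in> carrier R"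
    and "v \<otimes> a = u \<otimes> b"
  shows "a \<otimes> inv u = b \<otimes> inv v"
proof -
  note uv [simp] = assms(1-4) assms(1,2)[THEN Units_closed]
  have "a \<otimes> inv u = (v \<otimes> inv v) \<otimes> (a \<otimes> inv u)"
    by simp
  also have "\<dots> = (v \<otimes> a) \<otimes> (inv v \<otimes> inv u)"
    by (simp add: m_ac del: Units_r_inv)
  also have "\<dots> = b \<otimes> inv v \<otimes> (u \<otimes> inv u)"
    unfolding assms(5) by (simp add: m_ac del: Units_r_inv)
  also have "\<dots> = b \<otimes> inv v"
    by simp
  finally show ?thesis .
qed

section \<open>Values of regular functions at points of a principal open set\<close>

context principal_open
begin

lemma Dopen_pts_iff: "x \<in> pts (Dopen k A h) R \<longleftrightarrow> x \<in> alg_hom k A R \<and> x h \<in> Units R"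
  by (simp add: Dopen_def Spec_def)

lemma Dopen_push: "push (Dopen k A h) t x = compose (carrier A) t x"
  by (simp add: Dopen_def Spec_def)

text \<open>Two representatives \<open>a / h\<^sup>m\<close> and \<open>b / h\<^sup>n\<close> have the same value because the power of \<open>h\<close> in
  the equation between them becomes a unit under \<open>x\<close> and can be cancelled in \<open>R\<close>.\<close>

lemma loc_eval_frac:
  assumes "algebra k A" "algebra k R" "x \<in> pts (Dopen k A h) R" and a: "a \<in> carrier A"
  shows "loc_eval h R (frac a m) x = x a \<otimes>\<^bsub>R\<^esub> inv\<^bsub>R\<^esub> (x h [^]\<^bsub>R\<^esub> m)"
proof -
  have x: "x \<in> alg_hom k A R" and u: "x h \<in> Units R"
    using assms(3) by (simp_all add: Dopen_pts_iff)
  interpret x: ring_hom_cring A R x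
    by (rule alg_hom_ring_hom_cring[OF assms(1,2) x])
  have "x b \<otimes>\<^bsub>R\<^esub> inv\<^bsub>R\<^esub> (x h [^]\<^bsub>R\<^esub> n) = x a \<otimes>\<^bsub>R\<^esub> inv\<^bsub>R\<^esub> (x h [^]\<^bsub>R\<^esub> m)"
    if bn: "(b, n) \<in> frac a m" for b n
  proof -
    from bn obtain l :: nat where b: "b \<in> carrier A"
      and l: "h [^] l \<otimes> (h [^] n \<otimes> a) = h [^] l \<otimes> (h [^] m \<otimes> b)"
      by (auto simp: loc_frac_def)
    from arg_cong[OF l, of x]
    have "x h [^]\<^bsub>R\<^esub> l \<otimes>\<^bsub>R\<^esub> (x h [^]\<^bsub>R\<^esub> n \<otimes>\<^bsub>R\<^esub> x a) = x h [^]\<^bsub>R\<^esub> l \<otimes>\<^bsub>R\<^esub> (x h [^]\<^bsub>R\<^esub> m \<otimes>\<^bsub>R\<^esub> x b)"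
      using a b by simp
    then have "x h [^]\<^bsub>R\<^esub> m \<otimes>\<^bsub>R\<^esub> x b = x h [^]\<^bsub>R\<^esub> n \<otimes>\<^bsub>R\<^esub> x a"
      using a b u by (simp add: x.S.Units_l_cancel x.S.Units_pow_closed)
    then show ?thesis
      using a b u by (intro x.S.unit_fraction_eqI) (auto simp: x.S.Units_pow_closed)
  qed
  note value_eq = this
  show ?thesis
    unfolding loc_eval_def
  proof (rule the_equality)
    show "\<forall>(b, n)\<in>frac a m. x a \<otimes>\<^bsub>R\<^esub> inv\<^bsub>R\<^esub> (x h [^]\<^bsub>R\<^esub> m) = x b \<otimes>\<^bsub>R\<^esub> inv\<^bsub>R\<^esub> (x h [^]\<^bsub>R\<^esub> n)"
      by (simp add: split_beta value_eq)
  next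
    fix r assume "\<forall>(b, n)\<in>frac a m. r = x b \<otimes>\<^bsub>R\<^esub> inv\<^bsub>R\<^esub> (x h [^]\<^bsub>R\<^esub> n)"
    from bspec[OF this frac_self[OF a, of m]] show "r = x a \<otimes>\<^bsub>R\<^esub> inv\<^bsub>R\<^esub> (x h [^]\<^bsub>R\<^esub> m)"
      by simp
  qed
qed

text \<open>The unique extension of the point \<open>x\<close> along \<open>A \<rightarrow> A\<^sub>h\<close>. It is cut off outside \<open>A\<^sub>h\<close> because
  the homomorphisms in \<^const>\<open>alg_hom\<close> are extensional.\<close>

definition eval_hom :: "('k, 'a) module \<Rightarrow> ('a \<Rightarrow> 'a) \<Rightarrow> ('a \<times> nat) set \<Rightarrow> 'a" where
  "eval_hom R x = (\<lambda>f\<in>carrier (loc A h). loc_eval h R f x)"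

lemma eval_hom_alg_hom:
  assumes "algebra k A" "algebra k R" "x \<in> pts (Dopen k A h) R"
  shows "eval_hom R x \<in> alg_hom k (loc A h) R"
proof -
  have x: "x \<in> alg_hom k A R" and u [simp]: "x h \<in> Units R"
    using assms(3) by (simp_all add: Dopen_pts_iff)
  interpret k: algebra k A by fact
  interpret R: algebra k R by fact
  interpret x: ring_hom_cring A R x
    by (rule alg_hom_ring_hom_cring[OF assms(1,2) x])
  interpret L: algebra k "loc A h"
    by (rule loc_algebra[OF assms(1)])
  note ev = loc_eval_frac[OF assms]
  define i where "i m = inv\<^bsub>R\<^esub> (x h [^]\<^bsub>R\<^esub> m)" for m :: nat
  have [simp]: "x h [^]\<^bsub>R\<^esub> m \<in> Units R" for m :: nat
    by (simp add: R.Units_pow_closed)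
  have i [simp]: "i m \<in> carrier R" for m
    by (simp add: i_def)
  have ui: "x h [^]\<^bsub>R\<^esub> m \<otimes>\<^bsub>R\<^esub> (i m \<otimes>\<^bsub>R\<^esub> z) = z" if "z \<in> carrier R" for m z
    using that by (simp add: i_def flip: R.m_assoc)
  have ii: "i (m + n) = i m \<otimes>\<^bsub>R\<^esub> i n" for m n
  proof -
    have "x h [^]\<^bsub>R\<^esub> (m + n) \<otimes>\<^bsub>R\<^esub> (i m \<otimes>\<^bsub>R\<^esub> i n)
        = x h [^]\<^bsub>R\<^esub> m \<otimes>\<^bsub>R\<^esub> (i m \<otimes>\<^bsub>R\<^esub> (x h [^]\<^bsub>R\<^esub> n \<otimes>\<^bsub>R\<^esub> i n))"
      by (simp add: R.m_ac flip: R.nat_pow_mult)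
    also have "\<dots> = \<one>\<^bsub>R\<^esub>"
      using ui[of "\<one>\<^bsub>R\<^esub>"] by (simp add: i_def)
    finally have "x h [^]\<^bsub>R\<^esub> (m + n) \<otimes>\<^bsub>R\<^esub> (i m \<otimes>\<^bsub>R\<^esub> i n) = \<one>\<^bsub>R\<^esub>" .
    then show ?thesis
      unfolding i_def[of "m + n"] by (intro R.comm_inv_char) simp_all
  qed
  note ev' = ev[folded i_def]
  have "eval_hom R x \<in> ring_hom (loc A h) R"
  proof (rule ring_hom_memI)
    show "eval_hom R x X \<in> carrier R" if "X \<in> carrier (loc A h)" for X
      using that by (auto elim!: loc_cases simp: eval_hom_def ev')
    show "eval_hom R x (X \<otimes>\<^bsub>loc A h\<^esub> Y) = eval_hom R x X \<otimes>\<^bsub>R\<^esub> eval_hom R x Y"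
      if "X \<in> carrier (loc A h)" "Y \<in> carrier (loc A h)" for X Y
      using that by (auto elim!: loc_cases simp: eval_hom_def ev' loc_mult ii R.m_ac)
    show "eval_hom R x (X \<oplus>\<^bsub>loc A h\<^esub> Y) = eval_hom R x X \<oplus>\<^bsub>R\<^esub> eval_hom R x Y"
      if XY: "X \<in> carrier (loc A h)" "Y \<in> carrier (loc A h)" for X Y
    proof -
      obtain a m where X: "a \<in> carrier A" "X = frac a m" using XY(1) by (rule loc_cases)
      obtain b n where Y: "b \<in> carrier A" "Y = frac b n" using XY(2) by (rule loc_cases)
      have "(x h [^]\<^bsub>R\<^esub> n \<otimes>\<^bsub>R\<^esub> x a \<oplus>\<^bsub>R\<^esub> x h [^]\<^bsub>R\<^esub> m \<otimes>\<^bsub>R\<^esub> x b) \<otimes>\<^bsub>R\<^esub> (i m \<otimes>\<^bsub>R\<^esub> i n)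
          = x h [^]\<^bsub>R\<^esub> n \<otimes>\<^bsub>R\<^esub> (i n \<otimes>\<^bsub>R\<^esub> (x a \<otimes>\<^bsub>R\<^esub> i m)) \<oplus>\<^bsub>R\<^esub> x h [^]\<^bsub>R\<^esub> m \<otimes>\<^bsub>R\<^esub> (i m \<otimes>\<^bsub>R\<^esub> (x b \<otimes>\<^bsub>R\<^esub> i n))"
        using X Y by (simp add: R.l_distr R.r_distr R.m_ac)
      then show ?thesis
        using X Y by (simp add: eval_hom_def ev' loc_add ii ui)
    qed
    show "eval_hom R x \<one>\<^bsub>loc A h\<^esub> = \<one>\<^bsub>R\<^esub>"
      by (simp add: eval_hom_def loc_one ev)
  qed
  then show ?thesis
    by (auto elim!: loc_cases simp: alg_hom_def eval_hom_def ev' loc_smult[OF assms(1)]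
        alg_hom_smult[OF x] R.smult_assoc2)
qed

lemma Dopen_push_closed:
  assumes "algebra k A" "algebra k R" "algebra k R'"
    and "x \<in> pts (Dopen k A h) R" "t \<in> alg_hom k R R'"
  shows "compose (carrier A) t x \<in> pts (Dopen k A h) R'"
proof -
  interpret t: ring_hom_cring R R' t
    by (rule alg_hom_ring_hom_cring[OF assms(2,3,5)])
  show ?thesis
    using assms alg_hom_compose[OF assms(1) _ assms(5)]
    by (auto simp: Dopen_pts_iff compose_def t.hom_Units)
qed

lemma loc_eval_natural:
  assumes "algebra k A" "algebra k R" "algebra k R'"
    and x: "x \<in> pts (Dopen k A h) R" and t: "t \<in> alg_hom k R R'" and "f \<in> carrier (loc A h)"
  shows "loc_eval h R' f (compose (carrier A) t x) = t (loc_eval h R f x)"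
proof -
  interpret t: ring_hom_cring R R' t
    by (rule alg_hom_ring_hom_cring[OF assms(2,3) t])
  interpret x: ring_hom_cring A R x
    using x by (intro alg_hom_ring_hom_cring[OF assms(1,2)]) (simp add: Dopen_pts_iff)
  have u: "x h [^]\<^bsub>R\<^esub> m \<in> Units R" for m :: nat
    using x by (simp add: Dopen_pts_iff t.R.Units_pow_closed)
  from assms(6) obtain a m where "a \<in> carrier A" "f = frac a m" by (rule loc_cases)
  then show ?thesis
    using u[of m] t.hom_Units(2)[OF u[of m]]
    by (simp add: loc_eval_frac[OF assms(1,3) Dopen_push_closed[OF assms(1-5)]]
        loc_eval_frac[OF assms(1,2) x] compose_eq)
qed

text \<open>The value of \<open>f\<close> at \<open>x\<close> is the image of the unit \<open>f\<close> under \<open>eval_hom R x\<close>, hence a unit.\<close>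

lemma morphism_loc_eval:
  assumes "algebra k A" "f \<in> Units (loc A h)"
  shows "morphism k (Dopen k A h) Gm (\<lambda>R. loc_eval h R f)"
  unfolding morphism_def
proof (intro conjI allI impI ballI)
  interpret L: algebra k "loc A h" by (rule loc_algebra[OF assms(1)])
  have f: "f \<in> carrier (loc A h)" using assms(2) by auto
  fix R x assume R: "algebra k R" and x: "x \<in> pts (Dopen k A h) R"
  interpret e: ring_hom_cring "loc A h" R "eval_hom R x"
    by (rule alg_hom_ring_hom_cring[OF loc_algebra[OF assms(1)] R eval_hom_alg_hom[OF assms(1) R x]])
  show "loc_eval h R f x \<in> pts Gm R"
    using e.hom_Units(1)[OF assms(2)] f by (simp add: eval_hom_def Gm_def)
  fix R' :: "('k, 'a) module" and t assume "algebra k R'" "t \<in> alg_hom k R R'"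
  then show "loc_eval h R' f (push (Dopen k A h) t x) = push Gm t (loc_eval h R f x)"
    using loc_eval_natural[OF assms(1) R _ x _ f] by (simp add: Dopen_push Gm_def)
qed

section \<open>A copy of the localization in the universe\<close>

text \<open>A fraction is determined by any pair \<open>(a, m)\<close> that it contains, so choosing one pair embeds
  \<open>A\<^sub>h\<close> into the product of the universe and the natural numbers, which has the cardinality of the
  universe.\<close>

lemma loc_embeds:
  includes cardinal_syntax
  assumes "infinite (UNIV :: 'a set)"
  shows "\<exists>j :: ('a \<times> nat) set \<Rightarrow> 'a. inj_on j (carrier (loc A h))"
proof -
  have "|UNIV :: nat set| \<le>o |UNIV :: 'a set|"
    using assms by (simp add: infinite_iff_card_of_nat)
  then have "|(UNIV :: 'a set) \<times> (UNIV :: nat set)| \<le>o |UNIV :: 'a set|"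
    using assms card_of_Times_infinite[of "UNIV :: 'a set" "UNIV :: nat set"]
    by (simp add: ordIso_iff_ordLeq)
  then obtain p :: "'a \<times> nat \<Rightarrow> 'a" where p: "inj p"
    by (auto simp flip: card_of_ordLeq)
  define r where "r X = (SOME y. y \<in> X)" for X :: "('a \<times> nat) set"
  have "frac (fst (r X)) (snd (r X)) = X" if "X \<in> carrier (loc A h)" for X
  proof -
    from that obtain a m where X: "a \<in> carrier A" "X = frac a m" by (rule loc_cases)
    have "r (frac a m) \<in> frac a m"
      unfolding r_def by (rule someI[where x = "(a, m)"]) (rule frac_self[OF X(1)])
    then have "(fst (r (frac a m)), snd (r (frac a m))) \<in> frac a m" by simp
    from frac_eqI_mem[OF X(1) this] show ?thesis unfolding X(2) .
  qed
  then have "inj_on r (carrier (loc A h))"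
    by (rule inj_on_inverseI[where g = "\<lambda>y. frac (fst y) (snd y)"])
  then have "inj_on (p \<circ> r) (carrier (loc A h))"
    by (rule comp_inj_on[OF _ inj_on_subset[OF p subset_UNIV]])
  then show ?thesis by blast
qed

end

text \<open>The structure of \<open>L\<close> carried over to its image under \<open>j\<close>, which is meant to be injective
  on \<open>L\<close>; then \<open>j\<close> is an isomorphism.\<close>

definition transport :: "('a \<Rightarrow> 'b) \<Rightarrow> ('k, 'a) module \<Rightarrow> ('k, 'b) module" where
  "transport j L =
     (let i = inv_into (carrier L) j
      in \<lparr>carrier = j ` carrier L,
          mult = (\<lambda>x y. j (i x \<otimes>\<^bsub>L\<^esub> i y)), one = j \<one>\<^bsub>L\<^esub>, zero = j \<zero>\<^bsub>L\<^esub>,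
          add = (\<lambda>x y. j (i x \<oplus>\<^bsub>L\<^esub> i y)), smult = (\<lambda>c x. j (c \<odot>\<^bsub>L\<^esub> i x))\<rparr>)"

lemma transport_algebra:
  assumes "algebra k L" "inj_on j (carrier L)"
  shows "algebra k (transport j L)"
  by (rule algebra_image[OF assms(1), of _ j]) (use assms(2) in \<open>auto simp: transport_def Let_def\<close>)

lemma transport_hom:
  assumes "algebra k L" "inj_on j (carrier L)"
  shows "restrict j (carrier L) \<in> alg_hom k L (transport j L)"
    and "restrict (inv_into (carrier L) j) (j ` carrier L) \<in> alg_hom k (transport j L) L"
proof -
  interpret L: algebra k L by fact
  show "restrict j (carrier L) \<in> alg_hom k L (transport j L)"
    "restrict (inv_into (carrier L) j) (j ` carrier L) \<in> alg_hom k (transport j L) L"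
    using assms(2)
    by (auto simp: alg_hom_def ring_hom_def transport_def Let_def dest!: inj_onD[OF assms(2)])
qed

section \<open>Morphisms from a principal open set to the multiplicative group\<close>

context principal_open
begin

text \<open>Let \<open>B\<close> be a copy of \<open>A\<^sub>h\<close> in the universe and \<open>x\<^sub>0 : A \<rightarrow> B\<close> the universal point. Every
  point \<open>x\<close> over \<open>R\<close> is the push-forward of \<open>x\<^sub>0\<close> along the homomorphism \<open>t : B \<rightarrow> R\<close> that
  evaluates at \<open>x\<close>, so by naturality \<open>\<Phi>(x) = t(\<Phi>(x\<^sub>0))\<close> is the value at \<open>x\<close> of the
  element of \<open>A\<^sub>h\<close> that corresponds to \<open>\<Phi>(x\<^sub>0)\<close>.\<close>

lemma morphism_Dopen_Gm_is_loc_eval: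
  assumes "infinite (UNIV :: 'a set)" and A: "algebra k A"
    and \<Phi>: "morphism k (Dopen k A h) Gm \<Phi>"
  shows "\<exists>f\<in>Units (loc A h). mor_eq k (Dopen k A h) \<Phi> (\<lambda>R. loc_eval h R f)"
proof -
  let ?L = "loc A h"
  interpret k: algebra k A by fact
  have L: "algebra k ?L" by (rule loc_algebra[OF A])
  interpret L: algebra k ?L by fact
  obtain j :: "('a \<times> nat) set \<Rightarrow> 'a" where j: "inj_on j (carrier ?L)"
    using loc_embeds[OF assms(1)] by blast
  define B where "B = transport j ?L"
  have B: "algebra k B"
    unfolding B_def by (rule transport_algebra[OF L j])
  define i where "i = restrict (inv_into (carrier ?L) j) (j ` carrier ?L)"
  have carB: "carrier B = j ` carrier ?L" by (simp add: B_def transport_def Let_def)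
  have jhom: "restrict j (carrier ?L) \<in> alg_hom k ?L B" and ihom: "i \<in> alg_hom k B ?L"
    using transport_hom[OF L j] by (simp_all add: B_def i_def)
  have ij: "i (j X) = X" if "X \<in> carrier ?L" for X
    using that j by (simp add: i_def)
  interpret j: ring_hom_cring ?L B "restrict j (carrier ?L)"
    by (rule alg_hom_ring_hom_cring[OF L B jhom])
  interpret i: ring_hom_cring B ?L i
    by (rule alg_hom_ring_hom_cring[OF B L ihom])
  have canon: "(\<lambda>a\<in>carrier A. frac a 0) \<in> alg_hom k A ?L"
    by (auto simp: alg_hom_def ring_hom_def loc_mult loc_add loc_one loc_smult[OF A])
  define x0 where "x0 = compose (carrier A) (restrict j (carrier ?L)) (\<lambda>a\<in>carrier A. frac a 0)"
  have x0_eq: "x0 a = j (frac a 0)" if "a \<in> carrier A" for a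
    using that by (simp add: x0_def compose_eq)
  have x0: "x0 \<in> pts (Dopen k A h) B"
    using alg_hom_compose[OF A canon jhom] j.hom_Units(1)[OF frac_h_Units]
    by (simp add: Dopen_pts_iff x0_def compose_eq)
  define f where "f = i (\<Phi> B x0)"
  have s: "\<Phi> B x0 \<in> Units B"
    using \<Phi> B x0 by (auto simp: morphism_def Gm_def)
  then have "f \<in> Units ?L" unfolding f_def by (rule i.hom_Units)
  moreover have "\<Phi> R x = loc_eval h R f x" if R: "algebra k R" and x: "x \<in> pts (Dopen k A h) R" for R x
  proof -
    define t where "t = compose (carrier B) (eval_hom R x) i"
    have t: "t \<in> alg_hom k B R"
      unfolding t_def by (rule alg_hom_compose[OF B ihom eval_hom_alg_hom[OF A R x]])
    have xh: "x \<in> alg_hom k A R" using x by (simp add: Dopen_pts_iff)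
    interpret x: ring_hom_cring A R x by (rule alg_hom_ring_hom_cring[OF A R xh])
    have "compose (carrier A) t x0 = x"
    proof (rule extensionalityI[of _ "carrier A"])
      show "x \<in> extensional (carrier A)" using xh by (simp add: alg_hom_def)
      fix a assume "a \<in> carrier A"
      then show "compose (carrier A) t x0 a = x a"
        by (simp add: compose_eq x0_eq t_def carB ij eval_hom_def loc_eval_frac[OF A R x])
    qed simp
    then have "\<Phi> R x = t (\<Phi> B x0)"
      using \<Phi> B R t x0 by (auto simp: morphism_def Dopen_push Gm_def)
    also have "\<dots> = loc_eval h R f x"
      using s i.hom_closed by (simp add: t_def f_def compose_eq eval_hom_def j.S.Units_closed)
    finally show ?thesis .
  qed
  ultimately show ?thesis by (auto simp: mor_eq_def)
qed

text \<open>The hypothesis on \<open>\<Phi>\<close> concerns points of \<open>D(h)\<close> only; stability makes it applicable at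
  \<open>\<beta>(w, x)\<close> as well as at \<open>x\<close>.\<close>

lemma loc_eval_equivariant_iff_semi_invariant:
  assumes "mor_eq k (Dopen k A h) \<Phi> (\<lambda>R. loc_eval h R f)"
    and "Gm_stable k \<beta> (Dopen k A h)"
  shows "mor_eq k (Gm \<times>\<^sub>F Dopen k A h) (\<Phi> \<circ>\<^sub>M \<beta>) (gamma q \<circ>\<^sub>M id_times \<Phi>)
     \<longleftrightarrow> semi_invariant k A h \<beta> q f"
  using assms
  by (auto simp: mor_eq_def mor_comp_def prod_functor_def gamma_def id_times_def
      semi_invariant_def Gm_stable_def)

end

section \<open>Equivariant morphisms and semi-invariants\<close>

theorem proposition1p2:
  fixes k :: "'k ring"
    and A :: "('k, 'u) module"
    and \<beta> :: "('k, 'u, 'u \<times> ('u \<Rightarrow> 'u), 'u \<Rightarrow> 'u) kmap"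
    and h :: 'u
    and q :: nat
  assumes "infinite (UNIV :: 'u set)"
    and "field k"
    and "affine_Gm_variety k A \<beta>"
    and "h \<in> carrier A"
    and "Gm_stable k \<beta> (Dopen k A h)"
    and "q > 0"
  shows "(\<exists>\<Phi> :: ('k, 'u, 'u \<Rightarrow> 'u, 'u) kmap.
            morphism k (Dopen k A h) Gm \<Phi> \<and>
            mor_eq k (Gm \<times>\<^sub>F Dopen k A h) (\<Phi> \<circ>\<^sub>M \<beta>) (gamma q \<circ>\<^sub>M id_times \<Phi>))
     \<longleftrightarrow>
         (\<exists>(e :: nat) g. g \<in> Units (loc A h) \<and>
            semi_invariant k A h \<beta> q
              (g \<otimes>\<^bsub>loc A h\<^esub> inv\<^bsub>loc A h\<^esub> (loc_frac A h h 0 [^]\<^bsub>loc A h\<^esub> e)))"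
  (is "?a \<longleftrightarrow> ?b")
proof -
  let ?L = "loc A h"
  have A: "algebra k A"
    using assms(3) by (simp add: affine_Gm_variety_def affine_variety_def)
  then interpret principal_open A h
    using assms(4) by (auto simp: principal_open_def principal_open_axioms_def algebra.M_cring)
  interpret L: cring ?L by (rule loc_cring)
  show ?thesis
  proof
    assume ?a
    then obtain \<Phi> :: "('k, 'u, 'u \<Rightarrow> 'u, 'u) kmap" where \<Phi>: "morphism k (Dopen k A h) Gm \<Phi>"
      and eq: "mor_eq k (Gm \<times>\<^sub>F Dopen k A h) (\<Phi> \<circ>\<^sub>M \<beta>) (gamma q \<circ>\<^sub>M id_times \<Phi>)"
      by blast
    obtain f where f: "f \<in> Units ?L" "mor_eq k (Dopen k A h) \<Phi> (\<lambda>R. loc_eval h R f)"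
      using morphism_Dopen_Gm_is_loc_eval[OF assms(1) A \<Phi>] by blast
    then have "semi_invariant k A h \<beta> q f"
      using eq assms(5) by (simp add: loc_eval_equivariant_iff_semi_invariant)
    (* f is f / h^0 *)
    then show ?b
      using f(1) by (intro exI[of _ 0] exI[of _ f]) (simp add: L.Units_closed)
  next
    assume ?b
    then obtain e :: nat and g where g: "g \<in> Units ?L"
      and semi: "semi_invariant k A h \<beta> q (g \<otimes>\<^bsub>?L\<^esub> inv\<^bsub>?L\<^esub> (frac h 0 [^]\<^bsub>?L\<^esub> e))"
      by blast
    define f where "f = g \<otimes>\<^bsub>?L\<^esub> inv\<^bsub>?L\<^esub> (frac h 0 [^]\<^bsub>?L\<^esub> e)"
    have "f \<in> Units ?L"
      unfolding f_def using g frac_h_Units by (simp add: L.Units_pow_closed)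
    then have "morphism k (Dopen k A h) Gm (\<lambda>R. loc_eval h R f)"
      by (rule morphism_loc_eval[OF A])
    moreover have "mor_eq k (Gm \<times>\<^sub>F Dopen k A h) ((\<lambda>R. loc_eval h R f) \<circ>\<^sub>M \<beta>)
        (gamma q \<circ>\<^sub>M id_times (\<lambda>R. loc_eval h R f))"
      using semi assms(5) loc_eval_equivariant_iff_semi_invariant[of k "\<lambda>R. loc_eval h R f" f \<beta> q]
      by (simp add: f_def mor_eq_def)
    ultimately show ?a by blast
  qed
qed

end
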